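(* Let $\rho\in[0,1)$ and let the controller be $\kappa(x,\boldsymbol y)=\omega\sum_{i\in\mathcal I}y_i(x)$, i.e. $K_i=\omega I_m$ for all $i\in\mathcal I$ with a common scalar $\omega$. Let $\bar B=B(\mathbf 1_N^\top\otimes I_m)=[B\ \cdots\ B]\in\mathbb R^{n\times mN}$ and let $\hat\theta$ be as in the context, with $\hat\theta\le\|\mathrm{col}((Q_i)_{i\in\mathcal I})A\|\,\|B\|$. Then the light-touch design problem $$\min_{K,X,\lambda}\ \|K-(\mathbf 1_N^\top\otimes I_m)\|\quad\text{s.t.}\quad\begin{bmatrix} A^\top X A-\rho^2 X & A^\top X B K \\ (X B K)^\top A & (B K)^\top X B K \end{bmatrix}+\lambda\begin{bmatrix} (\bar\theta/\eta)^2 I & 0 \\ 0 & -I \end{bmatrix}\preccurlyeq 0,$$ $$X\in\mathbb S^n_{\succ0},\ \lambda\ge0,\ \|K_i\|\le1,\ [K_i]_{hk}\ge0\ \ \forall i\in\mathcal I,$$ restricted to $K=[\omega I_m\ \cdots\ \omega I_m]$ and with $\bar\theta=\omega\hat\theta$, reduces to the bilinear matrix inequality problem $$\min_{\omega,X,\lambda}\ -\omega\quad\text{s.t.}\quad\begin{bmatrix} -\rho^2 X+\lambda(\hat\theta/\eta)^2\omega^2 I & 0 & A^\top X \\ 0 & -\lambda I & \omega\bar B^\top X \\ X A & \omega X\bar B & -X \end{bmatrix}\preccurlyeq 0,\quad\omega\in[0,1],\ \lambda\ge0,\ X\in\mathbb S^n_{\succ0},$$ in the sense that a triple $(\omega,X,\lambda)$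 is feasible (respectively optimal) for the former problem if and only if it is feasible (respectively optimal) for the latter.
   Context: $\mathbb S^n_{\succ0}$ is the set of symmetric positive definite $n\times n$ matrices; $\|\cdot\|$ is the spectral norm for matrices; $\mathrm{col}$ stacks its arguments vertically; $\mathbf 1_N$ is the all-ones vector. $A\in\mathbb R^{n\times n}$, $B\in\mathbb R^{n\times m}$, $N$ agents indexed by $\mathcal I=\{1,\dots,N\}$, each with decision $y_i\in\mathbb R^m$, and $K=[K_1\ \cdots\ K_N]\in\mathbb R^{m\times mN}$ with blocks $K_i\in\mathbb R^{m\times m}$. The agents play a game with costs $J_i=\frac12\|Ax+BK\boldsymbol y-\bar x_i\|^2_{Q_i}+f_i(y_i,\boldsymbol y_{-i})$, $Q_i\succ0$; $\eta>0$ denotes a strong monotonicity constant of the pseudo-gradient $F(\cdot,x)$, $F(\boldsymbol y,x)=\mathrm{col}((\nabla_{y_i}J_i)_{i})$, and $\bar\theta$ an upper bound on $\|\nabla_xF\|$ valid for the considered gains. The block $K_i^\top B^\top Q_iA$ of $\nabla_xF$ is linear in $K_i$, so that, with $\hat\theta$ denoting the bound on $\|\nabla_xF\|$ corresponding to $K_i=I_m$ for all $i$, the bound corresponding to $K_i=\omega I_m$ is $\omega\hat\theta$. In this statement $\eta$ and $\hat\theta$ are fixed positive constants. *)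

theory Defs
  imports "HOL-Analysis.Analysis"
begin

(* Agents are the elements of a finite type 'i (so N = CARD('i)); a stacked vector in R^(mN) has
   type real^('i \<times> 'm), the component (i, h) being the h-th entry of block i. *)

definition symmetric_mat :: "real^'n^'n \<Rightarrow> bool" where
  "symmetric_mat M \<longleftrightarrow> transpose M = M"

definition pos_def :: "real^'n^'n \<Rightarrow> bool" where
  "pos_def M \<longleftrightarrow> symmetric_mat M \<and> (\<forall>v. v \<noteq> 0 \<longrightarrow> v \<bullet> (M *v v) > 0)"

definition neg_semidef :: "real^'n^'n \<Rightarrow> bool" where
  "neg_semidef M \<longleftrightarrow> symmetric_mat M \<and> (\<forall>v. v \<bullet> (M *v v) \<le> 0)"

(* The type-class norm on real^'n^'m is the Frobenius norm, hence the operator norm here. *)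
definition spectral_norm :: "real^'n^'m \<Rightarrow> real" where
  "spectral_norm M = onorm (\<lambda>v. M *v v)"

subsection \<open>Block vectors and block matrices\<close>

definition vec_block :: "real^('i::finite \<times> 'm::finite) \<Rightarrow> 'i \<Rightarrow> real^'m" where
  "vec_block y i = (\<chi> h. y $ (i, h))"

definition col_vec :: "('i::finite \<Rightarrow> real^'m::finite) \<Rightarrow> real^('i \<times> 'm)" where
  "col_vec v = (\<chi> p. v (fst p) $ snd p)"

definition col_mat :: "('i::finite \<Rightarrow> real^'n^'k::finite) \<Rightarrow> real^'n^('i \<times> 'k)" where
  "col_mat M = (\<chi> p. M (fst p) $ snd p)"

definition row_mat :: "('i::finite \<Rightarrow> real^'m::finite^'k) \<Rightarrow> real^('i \<times> 'm)^'k" where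
  "row_mat M = (\<chi> h p. M (fst p) $ h $ snd p)"

definition gain_block :: "real^('i::finite \<times> 'm::finite)^'k \<Rightarrow> 'i \<Rightarrow> real^'m^'k" where
  "gain_block K i = (\<chi> h k. K $ h $ (i, k))"

definition block2 ::
  "real^'a^'c \<Rightarrow> real^'b^'c \<Rightarrow> real^'a^'d \<Rightarrow> real^'b^'d
    \<Rightarrow> real^('a::finite + 'b::finite)^('c::finite + 'd::finite)" where
  "block2 M11 M12 M21 M22 = (\<chi> r c.
     case r of
       Inl r' \<Rightarrow> (case c of Inl c' \<Rightarrow> M11 $ r' $ c' | Inr c' \<Rightarrow> M12 $ r' $ c')
     | Inr r' \<Rightarrow> (case c of Inl c' \<Rightarrow> M21 $ r' $ c' | Inr c' \<Rightarrow> M22 $ r' $ c'))"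

definition block3 ::
  "real^'a^'a \<Rightarrow> real^'b^'a \<Rightarrow> real^'c^'a \<Rightarrow>
   real^'a^'b \<Rightarrow> real^'b^'b \<Rightarrow> real^'c^'b \<Rightarrow>
   real^'a^'c \<Rightarrow> real^'b^'c \<Rightarrow> real^'c^'c \<Rightarrow>
   real^('a::finite + 'b::finite + 'c::finite)^('a + 'b + 'c)" where
  "block3 M11 M12 M13 M21 M22 M23 M31 M32 M33 = (\<chi> r c.
     case r of
       Inl r' \<Rightarrow> (case c of Inl c' \<Rightarrow> M11 $ r' $ c'
                 | Inr (Inl c') \<Rightarrow> M12 $ r' $ c' | Inr (Inr c') \<Rightarrow> M13 $ r' $ c')
     | Inr (Inl r') \<Rightarrow> (case c of Inl c' \<Rightarrow> M21 $ r' $ c'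
                 | Inr (Inl c') \<Rightarrow> M22 $ r' $ c' | Inr (Inr c') \<Rightarrow> M23 $ r' $ c')
     | Inr (Inr r') \<Rightarrow> (case c of Inl c' \<Rightarrow> M31 $ r' $ c'
                 | Inr (Inl c') \<Rightarrow> M32 $ r' $ c' | Inr (Inr c') \<Rightarrow> M33 $ r' $ c'))"

(* The matrix 1_N^T \<otimes> I_m = [I_m ... I_m]; mat c is c times the identity. *)
definition ones_kron_id :: "real^('i::finite \<times> 'm::finite)^'m" where
  "ones_kron_id = row_mat (\<lambda>_. mat 1)"

definition common_gain :: "real \<Rightarrow> real^('i::finite \<times> 'm::finite)^'m" where
  "common_gain \<omega> = row_mat (\<lambda>_. mat \<omega>)"

lemma common_gain_controller:
  "common_gain \<omega> *v y = \<omega> *\<^sub>R (\<Sum>i\<in>UNIV. vec_block y i)"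
proof -
  have "(\<Sum>p\<in>UNIV. common_gain \<omega> $ h $ p * y $ p) = \<omega> * (\<Sum>i\<in>UNIV. y $ (i, h))" for h
  proof -
    have "(\<Sum>p\<in>UNIV. common_gain \<omega> $ h $ p * y $ p)
        = (\<Sum>i\<in>UNIV. \<Sum>k\<in>UNIV. common_gain \<omega> $ h $ (i, k) * y $ (i, k))"
      by (simp add: sum.cartesian_product UNIV_Times_UNIV case_prod_unfold)
    also have "\<dots> = (\<Sum>i\<in>UNIV. \<omega> * y $ (i, h))"
      by (intro sum.cong refl)
        (simp add: common_gain_def row_mat_def mat_def if_distrib[of "\<lambda>z. z * _"] cong: if_cong)
    finally show ?thesis by (simp add: sum_distrib_left)
  qed
  then show ?thesis
    by (simp add: vec_eq_iff matrix_vector_mult_def vec_block_def)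
qed

subsection \<open>The game\<close>

definition wnorm_sq :: "real^'n^'n \<Rightarrow> real^'n \<Rightarrow> real" where
  "wnorm_sq Q v = v \<bullet> (Q *v v)"

definition agent_cost ::
  "real^'n^'n \<Rightarrow> real^'m^'n \<Rightarrow> ('i \<Rightarrow> real^'n^'n) \<Rightarrow> ('i \<Rightarrow> real^'n) \<Rightarrow>
   ('i \<Rightarrow> real^('i::finite \<times> 'm::finite) \<Rightarrow> real) \<Rightarrow> real^('i \<times> 'm)^'m \<Rightarrow>
   'i \<Rightarrow> real^('i \<times> 'm) \<Rightarrow> real^'n \<Rightarrow> real" where
  "agent_cost A B Q xbar f K i y x =
     1/2 * wnorm_sq (Q i) (A *v x + (B ** K) *v y - xbar i) + f i y"

definition with_decision ::
  "real^('i::finite \<times> 'm::finite) \<Rightarrow> 'i \<Rightarrow> real^'m \<Rightarrow> real^('i \<times> 'm)" where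
  "with_decision y i v = col_vec ((vec_block y)(i := v))"

definition gradient :: "('a::real_inner \<Rightarrow> real) \<Rightarrow> 'a \<Rightarrow> 'a" where
  "gradient g v = (THE D. GDERIV g v :> D)"

definition pseudo_gradient ::
  "real^'n^'n \<Rightarrow> real^'m^'n \<Rightarrow> ('i \<Rightarrow> real^'n^'n) \<Rightarrow> ('i \<Rightarrow> real^'n) \<Rightarrow>
   ('i \<Rightarrow> real^('i::finite \<times> 'm::finite) \<Rightarrow> real) \<Rightarrow> real^('i \<times> 'm)^'m \<Rightarrow>
   real^('i \<times> 'm) \<Rightarrow> real^'n \<Rightarrow> real^('i \<times> 'm)" where
  "pseudo_gradient A B Q xbar f K y x =
     col_vec (\<lambda>i. gradient (\<lambda>v. agent_cost A B Q xbar f K i (with_decision y i v) x)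
                            (vec_block y i))"

definition strongly_monotone :: "real \<Rightarrow> ('a::real_inner \<Rightarrow> 'a) \<Rightarrow> bool" where
  "strongly_monotone \<eta> G \<longleftrightarrow> (\<forall>y z. (G y - G z) \<bullet> (y - z) \<ge> \<eta> * (norm (y - z))\<^sup>2)"

subsection \<open>The two design problems\<close>

definition light_touch_objective :: "real^('i::finite \<times> 'm::finite)^'m \<Rightarrow> real" where
  "light_touch_objective K = spectral_norm (K - ones_kron_id)"

definition light_touch_feasible ::
  "real^'n^'n \<Rightarrow> real^'m^'n \<Rightarrow> real \<Rightarrow> real \<Rightarrow> real \<Rightarrow>
   real^('i::finite \<times> 'm::finite)^'m \<Rightarrow> real^'n^'n \<Rightarrow> real \<Rightarrow> bool" where
  "light_touch_feasible A B \<rho> \<eta> \<theta>bar K X l \<longleftrightarrow>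
     neg_semidef
       (block2
          (transpose A ** X ** A - \<rho>\<^sup>2 *\<^sub>R X)   (transpose A ** X ** B ** K)
          (transpose (X ** B ** K) ** A)      (transpose (B ** K) ** X ** B ** K)
        + l *\<^sub>R block2
          (mat ((\<theta>bar / \<eta>)\<^sup>2))                 0
          0                                   (- mat 1))
     \<and> pos_def X \<and> l \<ge> 0
     \<and> (\<forall>i. spectral_norm (gain_block K i) \<le> 1)
     \<and> (\<forall>i h k. gain_block K i $ h $ k \<ge> 0)"

definition bmi_feasible ::
  "real^'n^'n \<Rightarrow> real^('i::finite \<times> 'm::finite)^'n \<Rightarrow> real \<Rightarrow> real \<Rightarrow> real \<Rightarrow>
   real \<Rightarrow> real^'n^'n \<Rightarrow> real \<Rightarrow> bool" where
  "bmi_feasible A Bbar \<rho> \<eta> \<theta>hat \<omega> X l \<longleftrightarrow>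
     neg_semidef
       (block3
          (- (\<rho>\<^sup>2 *\<^sub>R X) + (l * (\<theta>hat / \<eta>)\<^sup>2 * \<omega>\<^sup>2) *\<^sub>R mat 1)  0  (transpose A ** X)
          0         (- (l *\<^sub>R mat 1))         (\<omega> *\<^sub>R (transpose Bbar ** X))
          (X ** A)  (\<omega> *\<^sub>R (X ** Bbar))  (- X))
     \<and> \<omega> \<in> {0..1} \<and> l \<ge> 0 \<and> pos_def X"

end

theory Submission
  imports Defs
begin

text \<open>With \<open>z = A u + \<omega> Bbar v\<close>, the quadratic form of the first matrix constraint contains
  \<open>z \<bullet> X z\<close> where that of the second contains \<open>2 w \<bullet> X z - w \<bullet> X w\<close>. Since \<open>X\<close> is positive
  definite, completing the square shows that the former is the maximum of the latter over \<open>w\<close>,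
  attained at \<open>w = z\<close> (a Schur complement). The gain constraints say \<open>\<omega> \<in> {0..1}\<close>, where the
  first objective is \<open>1 - \<omega>\<close> times the positive norm of \<open>ones_kron_id\<close>.\<close>

section \<open>Transposes and matrix-vector products\<close>

lemma inner_transpose_mult:
  fixes A :: "real^'n^'m"
  shows "x \<bullet> (transpose A *v y) = (A *v x) \<bullet> y"
  by (metis dot_lmul_matrix inner_commute transpose_matrix_vector)

lemma mat_vector_mult: "(mat c :: real^'n^'n) *v x = c *\<^sub>R x"
  by (simp add: vec_eq_iff matrix_vector_mult_def mat_def if_distrib[of "\<lambda>z. z * _"] cong: if_cong)

lemma transpose_add: "transpose ((M :: real^'n^'m) + M') = transpose M + transpose M'"
  by (simp add: vec_eq_iff transpose_def)

lemma transpose_diff: "transpose ((M :: real^'n^'m) - M') = transpose M - transpose M'"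
  by (simp add: vec_eq_iff transpose_def)

lemma transpose_uminus: "transpose (- (M :: real^'n^'m)) = - transpose M"
  by (simp add: vec_eq_iff transpose_def)

lemma transpose_zero: "transpose (0 :: real^'n^'m) = 0"
  by (simp add: vec_eq_iff transpose_def)

lemma matrix_vector_mult_uminus: "(- (M :: real^'n^'m)) *v x = - (M *v x)"
  by (simp add: vec_eq_iff matrix_vector_mult_def sum_negf)

lemmas transpose_linear =
  transpose_scalar transpose_add transpose_diff transpose_uminus transpose_zero

section \<open>Splitting stacked vectors and multiplying by block matrices\<close>

definition inl_vec :: "real^('a::finite + 'b::finite) \<Rightarrow> real^'a" where
  "inl_vec x = (\<chi> i. x $ Inl i)"

definition inr_vec :: "real^('a::finite + 'b::finite) \<Rightarrow> real^'b" where
  "inr_vec x = (\<chi> i. x $ Inr i)"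

text \<open>Every pair of components is realised by a stacked vector, so a quantifier over stacked
  vectors can be traded for independent quantifiers over the components.\<close>

definition join_vec :: "real^'a \<Rightarrow> real^'b \<Rightarrow> real^('a::finite + 'b::finite)" where
  "join_vec u v = (\<chi> r. case r of Inl i \<Rightarrow> u $ i | Inr j \<Rightarrow> v $ j)"

lemma inl_join [simp]: "inl_vec (join_vec u v) = u"
  and inr_join [simp]: "inr_vec (join_vec u v) = v"
  by (simp_all add: inl_vec_def inr_vec_def join_vec_def vec_eq_iff)

lemma sum_UNIV_Plus:
  fixes g :: "'a::finite + 'b::finite \<Rightarrow> real"
  shows "sum g UNIV = (\<Sum>i\<in>UNIV. g (Inl i)) + (\<Sum>j\<in>UNIV. g (Inr j))"
  by (subst UNIV_Plus_UNIV[symmetric], subst sum.Plus) simp_all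

lemma inner_Plus: "x \<bullet> y = inl_vec x \<bullet> inl_vec y + inr_vec x \<bullet> inr_vec y"
  by (simp add: inner_vec_def sum_UNIV_Plus inl_vec_def inr_vec_def)

lemma block2_mult:
  "inl_vec (block2 M11 M12 M21 M22 *v x) = M11 *v inl_vec x + M12 *v inr_vec x"
  "inr_vec (block2 M11 M12 M21 M22 *v x) = M21 *v inl_vec x + M22 *v inr_vec x"
  by (simp_all add: vec_eq_iff matrix_vector_mult_def sum_UNIV_Plus block2_def inl_vec_def inr_vec_def)

text \<open>The index type nests to the right, so the second and third components of
  \<open>x\<close> are the two halves of \<open>inr_vec x\<close>.\<close>

lemma block3_mult:
  "inl_vec (block3 M11 M12 M13 M21 M22 M23 M31 M32 M33 *v x) =
     M11 *v inl_vec x + M12 *v inl_vec (inr_vec x) + M13 *v inr_vec (inr_vec x)"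
  "inl_vec (inr_vec (block3 M11 M12 M13 M21 M22 M23 M31 M32 M33 *v x)) =
     M21 *v inl_vec x + M22 *v inl_vec (inr_vec x) + M23 *v inr_vec (inr_vec x)"
  "inr_vec (inr_vec (block3 M11 M12 M13 M21 M22 M23 M31 M32 M33 *v x)) =
     M31 *v inl_vec x + M32 *v inl_vec (inr_vec x) + M33 *v inr_vec (inr_vec x)"
  by (simp_all add: vec_eq_iff matrix_vector_mult_def sum_UNIV_Plus block3_def inl_vec_def inr_vec_def)

lemma transpose_block2:
  "transpose (block2 M11 M12 M21 M22)
   = block2 (transpose M11) (transpose M21) (transpose M12) (transpose M22)"
  by (simp add: vec_eq_iff transpose_def block2_def split: sum.split)

lemma transpose_block3:
  "transpose (block3 M11 M12 M13 M21 M22 M23 M31 M32 M33)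
   = block3 (transpose M11) (transpose M21) (transpose M31)
            (transpose M12) (transpose M22) (transpose M32)
            (transpose M13) (transpose M23) (transpose M33)"
  by (simp add: vec_eq_iff transpose_def block3_def split: sum.split)

section \<open>The common gain: objective and gain constraints\<close>

lemma common_gain_eq: "common_gain \<omega> = \<omega> *\<^sub>R ones_kron_id"
  by (simp add: vec_eq_iff common_gain_def ones_kron_id_def row_mat_def mat_def)

lemma spectral_norm_scaleR: "spectral_norm (c *\<^sub>R M) = \<bar>c\<bar> * spectral_norm M"
  unfolding spectral_norm_def
  using onorm_scaleR[of "(*v) M" c] by (simp add: scaleR_matrix_vector_assoc)

lemma spectral_norm_mat: "spectral_norm (mat c :: real^'n^'n) = \<bar>c\<bar>"
proof -
  have "mat c = c *\<^sub>R (mat 1 :: real^'n^'n)"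
    by (simp add: vec_eq_iff mat_def)
  moreover have "spectral_norm (mat 1 :: real^'n^'n) = 1"
  proof -
    have "(*v) (mat 1 :: real^'n^'n) = (\<lambda>x. x)"
      by (simp add: fun_eq_iff)
    then show ?thesis
      by (simp add: spectral_norm_def onorm_id)
  qed
  ultimately show ?thesis
    by (simp add: spectral_norm_scaleR)
qed

lemma spectral_norm_pos:
  fixes M :: "real^'n^'m"
  assumes "M \<noteq> 0"
  shows "spectral_norm M > 0"
proof -
  have "\<exists>x. M *v x \<noteq> 0"
    using assms matrix_eq[of M 0] by auto
  then show ?thesis
    unfolding spectral_norm_def by (simp add: onorm_pos_lt)
qed

lemma ones_kron_id_nonzero: "(ones_kron_id :: real^('i::finite \<times> 'm::finite)^'m) \<noteq> 0"
proof
  assume "(ones_kron_id :: real^('i \<times> 'm)^'m) = 0"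
  then have "(ones_kron_id :: real^('i \<times> 'm)^'m) $ undefined $ (undefined, undefined) = 0"
    by simp
  then show False
    by (simp add: ones_kron_id_def row_mat_def mat_def)
qed

lemma gain_block_common_gain: "gain_block (common_gain \<omega>) i = mat \<omega>"
  by (simp add: vec_eq_iff gain_block_def common_gain_def row_mat_def)

lemma light_touch_objective_common_gain:
  "light_touch_objective (common_gain \<omega> :: real^('i::finite \<times> 'm::finite)^'m)
   = \<bar>\<omega> - 1\<bar> * spectral_norm (ones_kron_id :: real^('i \<times> 'm)^'m)"
proof -
  have "common_gain \<omega> - ones_kron_id = (\<omega> - 1) *\<^sub>R (ones_kron_id :: real^('i \<times> 'm)^'m)"
    by (simp add: common_gain_eq algebra_simps)
  then show ?thesis
    by (simp add: light_touch_objective_def spectral_norm_scaleR)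
qed

text \<open>Each block is a scalar matrix: its norm gives the upper bound on \<omega>, its diagonal
  entries give the lower bound, and its other entries vanish.\<close>

lemma common_gain_constraints_iff:
  "(\<forall>i. spectral_norm (gain_block (common_gain \<omega> :: real^('i::finite \<times> 'm::finite)^'m) i) \<le> 1)
    \<and> (\<forall>i h k. gain_block (common_gain \<omega> :: real^('i \<times> 'm)^'m) i $ h $ k \<ge> 0)
   \<longleftrightarrow> \<omega> \<in> {0..1}"
proof -
  have "(\<forall>h k. (mat \<omega> :: real^'m^'m) $ h $ k \<ge> 0) \<longleftrightarrow> \<omega> \<ge> 0"
    by (auto simp: mat_def)
  then show ?thesis
    by (auto simp: gain_block_common_gain spectral_norm_mat)
qed

section \<open>Quadratic forms of the two matrix constraints\<close>

lemmas quadratic_form_simps =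
  matrix_vector_mult_add_rdistrib matrix_vector_mult_diff_rdistrib matrix_vector_mult_uminus
  scaleR_matrix_vector_assoc[symmetric] matrix_vector_mul_assoc[symmetric] mat_vector_mult
  matrix_vector_right_distrib matrix_vector_mult_scaleR matrix_vector_mult_0
  inner_add_right inner_add_left inner_diff_right inner_minus_right
  inner_scaleR_right inner_scaleR_left inner_zero_right inner_transpose_mult

lemma square_completion:
  fixes X :: "real^'n^'n"
  assumes "symmetric_mat X"
  shows "(w - z) \<bullet> (X *v (w - z)) = w \<bullet> (X *v w) - 2 * (w \<bullet> (X *v z)) + z \<bullet> (X *v z)"
proof -
  have "z \<bullet> (X *v w) = w \<bullet> (X *v z)"
    using assms inner_transpose_mult[of z X w]
    by (simp add: symmetric_mat_def inner_commute)
  then show ?thesis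
    by (simp add: algebra_simps)
qed

text \<open>Here \<open>C\<close> plays the role of \<open>B ** K\<close>. The four blocks
  containing products with \<open>A\<close> or \<open>C\<close> add up to a single square in
  \<open>X\<close> of the predicted state \<open>A *v u + C *v v\<close>.\<close>

lemma neg_semidef_block2_iff:
  fixes A :: "real^'n^'n" and C :: "real^'p^'n" and X :: "real^'n^'n"
  assumes X: "symmetric_mat X"
  shows "neg_semidef
       (block2
          (transpose A ** X ** A - r *\<^sub>R X)   (transpose A ** X ** C)
          (transpose (X ** C) ** A)      (transpose C ** X ** C)
        + l *\<^sub>R block2 (mat s) 0 0 (- mat 1))
   \<longleftrightarrow> (\<forall>u v. (A *v u + C *v v) \<bullet> (X *v (A *v u + C *v v))
          - r * (u \<bullet> (X *v u)) + l * s * (u \<bullet> u) - l * (v \<bullet> v) \<le> 0)"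
    (is "neg_semidef ?M \<longleftrightarrow> (\<forall>u v. ?q u v \<le> 0)")
proof -
  have tX: "transpose X = X"
    using X by (simp add: symmetric_mat_def)
  \<comment> \<open>Symmetry of \<open>X\<close> turns the lower left block into
    \<open>transpose C ** X ** A\<close>, visibly the transpose of the upper right one.\<close>
  have M: "?M = block2
      (transpose A ** X ** A - r *\<^sub>R X + l *\<^sub>R mat s) (transpose A ** X ** C)
      (transpose C ** X ** A) (transpose C ** X ** C - l *\<^sub>R mat 1)"
    unfolding matrix_transpose_mul tX
    by (simp add: vec_eq_iff block2_def split: sum.split)
  have sym: "symmetric_mat ?M"
    unfolding symmetric_mat_def M
    by (simp add: transpose_linear transpose_block2 matrix_transpose_mul tX matrix_mul_assoc)
  \<comment> \<open>Transposes move across the inner product and matrix products become successive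
    applications; bilinearity then matches the expanded square.\<close>
  have "x \<bullet> (?M *v x) = ?q (inl_vec x) (inr_vec x)" for x
    unfolding M inner_Plus[of x] block2_mult quadratic_form_simps
    by (simp add: algebra_simps)
  then have "neg_semidef ?M \<longleftrightarrow> (\<forall>x. ?q (inl_vec x) (inr_vec x) \<le> 0)"
    unfolding neg_semidef_def using sym by simp
  moreover have "?q u v \<le> 0" if "\<forall>x. ?q (inl_vec x) (inr_vec x) \<le> 0" for u v
    using spec[OF that, of "join_vec u v"] by (simp only: inl_join inr_join)
  ultimately show ?thesis
    by blast
qed

text \<open>The third component \<open>w\<close> enters linearly through the off-diagonal blocks and
  quadratically through \<open>- X\<close>, which is the form needed for completing the square in
  \<open>w\<close>.\<close>

lemma neg_semidef_block3_iff:
  fixes A :: "real^'n^'n" and C :: "real^'p^'n" and X :: "real^'n^'n"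
  assumes X: "symmetric_mat X"
  shows "neg_semidef
       (block3
          (- (r *\<^sub>R X) + t *\<^sub>R mat 1)  0  (transpose A ** X)
          0         (- (l *\<^sub>R mat 1))         (\<omega> *\<^sub>R (transpose C ** X))
          (X ** A)  (\<omega> *\<^sub>R (X ** C))  (- X))
   \<longleftrightarrow> (\<forall>u v w. 2 * (w \<bullet> (X *v (A *v u + \<omega> *\<^sub>R (C *v v)))) - w \<bullet> (X *v w)
          - r * (u \<bullet> (X *v u)) + t * (u \<bullet> u) - l * (v \<bullet> v) \<le> 0)"
    (is "neg_semidef ?M \<longleftrightarrow> (\<forall>u v w. ?q u v w \<le> 0)")
proof -
  have tX: "transpose X = X"
    using X by (simp add: symmetric_mat_def)
  have comm: "y \<bullet> (X *v z) = z \<bullet> (X *v y)" for y z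
    using inner_transpose_mult[of y X z] by (simp add: tX inner_commute)
  have sym: "symmetric_mat ?M"
    unfolding symmetric_mat_def
    by (simp add: transpose_linear transpose_block3 matrix_transpose_mul tX)
  have "x \<bullet> (?M *v x) = ?q (inl_vec x) (inl_vec (inr_vec x)) (inr_vec (inr_vec x))" for x
    unfolding inner_Plus[of x] inner_Plus[of "inr_vec x"] block3_mult quadratic_form_simps
    \<comment> \<open>These instances bring the upper cross terms to the form of the lower ones, so
      that each pair gives the factor 2.\<close>
    by (simp add: comm[of "A *v _"] comm[of "C *v _" "inr_vec (inr_vec x)"] algebra_simps)
  then have "neg_semidef ?M
      \<longleftrightarrow> (\<forall>x. ?q (inl_vec x) (inl_vec (inr_vec x)) (inr_vec (inr_vec x)) \<le> 0)"
    unfolding neg_semidef_def using sym by simp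
  moreover have "?q u v w \<le> 0"
    if "\<forall>x. ?q (inl_vec x) (inl_vec (inr_vec x)) (inr_vec (inr_vec x)) \<le> 0" for u v w
    using spec[OF that, of "join_vec u (join_vec v w)"] by (simp only: inl_join inr_join)
  ultimately show ?thesis
    by blast
qed

text \<open>Both problems demand \<open>pos_def X\<close>, so only that case has content; there the
  two families of inequalities differ by one square in \<open>w\<close>.\<close>

lemma light_touch_feasible_iff_bmi_feasible:
  fixes A :: "real^'n^'n" and B :: "real^'m^'n"
  shows "light_touch_feasible A B \<rho> \<eta> (\<omega> * \<theta>) (common_gain \<omega> :: real^('i::finite \<times> 'm)^'m) X l
    \<longleftrightarrow> bmi_feasible A (B ** (ones_kron_id :: real^('i \<times> 'm)^'m)) \<rho> \<eta> \<theta> \<omega> X l"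
proof (cases "pos_def X")
  case True
  then have X: "symmetric_mat X" and pos: "v \<bullet> (X *v v) \<ge> 0" for v
    by (auto simp: pos_def_def) (metis inner_zero_left order.order_iff_strict)
  define C where "C = B ** (ones_kron_id :: real^('i \<times> 'm)^'m)"
  define s where "s = (\<omega> * \<theta> / \<eta>)\<^sup>2"
  define z where "z u v = A *v u + \<omega> *\<^sub>R (C *v v)" for u v
  have BK: "B ** common_gain \<omega> = \<omega> *\<^sub>R C"
    by (simp add: C_def common_gain_eq matrix_scalar_ac scalar_matrix_assoc)
  \<comment> \<open>The factor \<omega> in the bound \<omega> * \<theta> is squared with it, which
    produces the \<omega>-dependent corner entry of the second matrix.\<close>
  have ls: "l * (\<theta> / \<eta>)\<^sup>2 * \<omega>\<^sup>2 = l * s"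
    by (simp add: s_def power_mult_distrib power_divide)
  have "light_touch_feasible A B \<rho> \<eta> (\<omega> * \<theta>) (common_gain \<omega> :: real^('i::finite \<times> 'm)^'m) X l
      \<longleftrightarrow> (\<forall>u v. z u v \<bullet> (X *v z u v)
            - \<rho>\<^sup>2 * (u \<bullet> (X *v u)) + l * s * (u \<bullet> u) - l * (v \<bullet> v) \<le> 0)
        \<and> \<omega> \<in> {0..1} \<and> l \<ge> 0"
    using neg_semidef_block2_iff[OF X, of A "\<rho>\<^sup>2" "\<omega> *\<^sub>R C" l s] True
    unfolding light_touch_feasible_def common_gain_constraints_iff s_def[symmetric]
      matrix_mul_assoc[symmetric] BK z_def scaleR_matrix_vector_assoc
    by blast
  also have "\<dots> \<longleftrightarrow> (\<forall>u v w. 2 * (w \<bullet> (X *v z u v)) - w \<bullet> (X *v w)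
            - \<rho>\<^sup>2 * (u \<bullet> (X *v u)) + l * s * (u \<bullet> u) - l * (v \<bullet> v) \<le> 0)
        \<and> \<omega> \<in> {0..1} \<and> l \<ge> 0"
    (is "(\<forall>u v. ?p u v \<le> 0) \<and> _ \<longleftrightarrow> (\<forall>u v w. ?q u v w \<le> 0) \<and> _")
  proof -
    \<comment> \<open>The gap \<open>?p u v - ?q u v w\<close> is the \<open>X\<close>-form of
      \<open>w - z u v\<close>, hence nonnegative.\<close>
    have "?q u v w \<le> ?p u v" for u v w
      using pos[of "w - z u v"] square_completion[OF X, of w "z u v"] by linarith
    then have "?q u v w \<le> 0" if "\<forall>u v. ?p u v \<le> 0" for u v w
      using that by (meson order_trans)
    \<comment> \<open>The choice \<open>w = z u v\<close> closes the gap.\<close>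
    moreover have "?p u v \<le> 0" if "\<forall>u v w. ?q u v w \<le> 0" for u v
      using that[rule_format, of "z u v" u v] by linarith
    ultimately show ?thesis
      by blast
  qed
  also have "\<dots> \<longleftrightarrow> bmi_feasible A C \<rho> \<eta> \<theta> \<omega> X l"
    using neg_semidef_block3_iff[OF X, of "\<rho>\<^sup>2" "l * s" A l \<omega> C] True
    unfolding bmi_feasible_def ls z_def by blast
  finally show ?thesis
    unfolding C_def .
qed (simp add: light_touch_feasible_def bmi_feasible_def)

theorem mainTheorem2:
  fixes A :: "real^'n^'n" and B :: "real^'m^'n"
    and Q :: "'i::finite \<Rightarrow> real^'n^'n" and xbar :: "'i \<Rightarrow> real^'n"
    and f :: "'i \<Rightarrow> real^('i \<times> 'm) \<Rightarrow> real"
    and \<rho> \<eta> \<theta>hat :: real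
  defines "F \<equiv> \<lambda>\<omega>. pseudo_gradient A B Q xbar f (common_gain \<omega>)"
    and "Bbar \<equiv> B ** (ones_kron_id :: real^('i \<times> 'm)^'m)"
  assumes rho: "0 \<le> \<rho>" "\<rho> < 1"
    and Q: "\<And>i. pos_def (Q i)"
    and f_diff: "\<And>i y. (\<lambda>v. f i (with_decision y i v)) differentiable (at (vec_block y i))"
    and eta: "\<eta> > 0"
      "\<And>\<omega> x. \<omega> \<in> {0..1} \<Longrightarrow> strongly_monotone \<eta> (\<lambda>y. F \<omega> y x)"
    and theta: "\<theta>hat > 0"
      "\<And>y x. onorm (frechet_derivative (F 1 y) (at x)) \<le> \<theta>hat"
      "\<theta>hat \<le> spectral_norm (col_mat Q ** A) * spectral_norm B"
  shows "(\<forall>\<omega> X l.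
            light_touch_feasible A B \<rho> \<eta> (\<omega> * \<theta>hat)
              (common_gain \<omega> :: real^('i \<times> 'm)^'m) X l
            \<longleftrightarrow> bmi_feasible A Bbar \<rho> \<eta> \<theta>hat \<omega> X l)
       \<and> (\<forall>\<omega> X l.
            is_arg_min
              (\<lambda>(\<omega>, X, l). light_touch_objective (common_gain \<omega> :: real^('i \<times> 'm)^'m))
              (\<lambda>(\<omega>, X, l). light_touch_feasible A B \<rho> \<eta> (\<omega> * \<theta>hat)
                 (common_gain \<omega> :: real^('i \<times> 'm)^'m) X l)
              (\<omega>, X, l)
            \<longleftrightarrow> is_arg_min
              (\<lambda>(\<omega>, X, l). - \<omega>)
              (\<lambda>(\<omega>, X, l). bmi_feasible A Bbar \<rho> \<eta> \<theta>hat \<omega> X l)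
              (\<omega>, X, l))"
proof -
  let ?c = "spectral_norm (ones_kron_id :: real^('i \<times> 'm)^'m)"
  have feas: "light_touch_feasible A B \<rho> \<eta> (\<omega> * \<theta>hat) (common_gain \<omega> :: real^('i \<times> 'm)^'m) X l
      \<longleftrightarrow> bmi_feasible A Bbar \<rho> \<eta> \<theta>hat \<omega> X l" for \<omega> X l
    unfolding Bbar_def by (rule light_touch_feasible_iff_bmi_feasible)
  have range: "\<omega> \<le> 1" if "bmi_feasible A Bbar \<rho> \<eta> \<theta>hat \<omega> X l" for \<omega> X l
    using that by (simp add: bmi_feasible_def)
  have c: "?c > 0"
    by (intro spectral_norm_pos ones_kron_id_nonzero)
  \<comment> \<open>For gains at most 1 the absolute value opens to 1 - \<omega>, and the positive
    factor \<open>?c\<close> cancels from the strict comparison.\<close>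
  have obj: "light_touch_objective (common_gain \<omega>' :: real^('i \<times> 'm)^'m)
        < light_touch_objective (common_gain \<omega> :: real^('i \<times> 'm)^'m) \<longleftrightarrow> - \<omega>' < - \<omega>"
    if "\<omega> \<le> 1" "\<omega>' \<le> 1" for \<omega> \<omega>'
    using that c by (simp add: light_touch_objective_common_gain)
  show ?thesis
    \<comment> \<open>After \<open>feas\<close> both minimisations run over the same set; minimality
      only compares objective values strictly, and \<open>range\<close> provides the bounds that
      \<open>obj\<close> asks for.\<close>
    unfolding is_arg_min_def feas split_paired_Ex case_prod_conv
    using obj range by blast
qed

end
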